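(* Let $J_0$ and $J_1$ be two pairs of twin binary trees with $n$ nodes. Then $$J_0 \leq_{\mathrm{B}} J_1 \quad\text{if and only if}\quad \omega(\mathrm{ttd}(J_0))_i \leq \omega(\mathrm{ttd}(J_1))_i \ \text{ for all } 1 \leq i \leq n.$$
   Context: A binary tree is either a leaf (empty tree) or a node with a left and a right binary subtree. The canopy of a binary tree with $n$ nodes is the word of length $n-1$ on $\{0,1\}$ obtained by reading its leaves from left to right except the first and the last one, writing $0$ if the leaf is a right child and $1$ if it is a left child. A pair of twin binary trees with $n$ nodes is a pair $(T_L,T_R)$ of binary trees with $n$ nodes each whose canopies differ at every position $1 \leq i \leq n-1$. The Tamari diagram $\mathrm{td}(T)$ of a binary tree $T$ with $n$ nodes is the word of length $n$ whose $i$-th letter is the number of nodes in the right subtree of the $i$-th node of $T$ in inorder (left subtree, root, right subtree). For a pair of twin binary trees $J=(T_L,T_R)$, $\mathrm{ttd}(J) = (\mathrm{td}(T_L),\mathrm{td}(T_R))$; for $\delta = (\delta^L,\delta^R)$ of this form, $\omega(\delta)$ is the sequence of integers defined by $\omega(\delta)_i = -\delta^L_i$ if $\delta^L_i \neq 0$ and $\omega(\delta)_i = \delta^R_i$ otherwise, for $1 \leq i \leq n$. For a permutation $\sigma$ of $\{1,\dots,n\}$ (seen as a word), $\mathsf{P}(\sigma) = (T_L,T_R)$ where $T_L$ (resp. $T_R$) is the shape (labels forgotten) of the binary search tree obtained by inserting the letters of $\sigma$ from left to right (resp. from right to left) with the standard binary search tree leaf insertion (smaller letters go left, larger letters go right).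 This is a pair of twin binary trees. The permutohedron order $\leq_{\mathrm{P}}$ on permutations of size $n$ is the partial order in which $\sigma$ is covered by $\nu$ iff $\sigma = u\,ab\,v$ and $\nu = u\,ba\,v$ for some words $u,v$ and letters $a<b$. The Baxter order $\leq_{\mathrm{B}}$ on pairs of twin binary trees with $n$ nodes is defined by: $J_0 \leq_{\mathrm{B}} J_1$ iff there are permutations $\sigma, \nu$ of size $n$ with $\sigma \leq_{\mathrm{P}} \nu$, $\mathsf{P}(\sigma) = J_0$ and $\mathsf{P}(\nu) = J_1$. *)

theory Defs
  imports "HOL-Library.Tree" "HOL-Combinatorics.Multiset_Permutations"
begin

text \<open>
  Unlabelled binary trees are trees whose labels carry no information. The library function
  \<^const>\<open>size\<close> counts the nodes of a tree. Words are lists, hence indexed from \<open>0\<close>.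
\<close>

type_synonym shape = "unit tree"

text \<open>
  \<open>leaf_word b t\<close> reads the leaves of \<open>t\<close> from left to right, writing \<open>0\<close> for a right child and
  \<open>1\<close> for a left child; \<open>b\<close> is the letter written for \<open>t\<close> itself if \<open>t\<close> is a leaf. The value
  of \<open>b\<close> chosen in \<open>canopy\<close> is immaterial: it can only be used when \<open>t\<close> is a leaf, in which
  case the whole word is discarded.
\<close>

fun leaf_word :: "nat \<Rightarrow> shape \<Rightarrow> nat list" where
  "leaf_word b Leaf = [b]"
| "leaf_word b (Node l _ r) = leaf_word 1 l @ leaf_word 0 r"

definition canopy :: "shape \<Rightarrow> nat list" where
  "canopy t = butlast (tl (leaf_word 0 t))"

definition twin_trees :: "nat \<Rightarrow> shape \<times> shape \<Rightarrow> bool" where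
  "twin_trees n J \<longleftrightarrow> size (fst J) = n \<and> size (snd J) = n \<and>
     (\<forall>i < n - 1. canopy (fst J) ! i \<noteq> canopy (snd J) ! i)"

fun td :: "shape \<Rightarrow> nat list" where
  "td Leaf = []"
| "td (Node l _ r) = td l @ size r # td r"

definition ttd :: "shape \<times> shape \<Rightarrow> nat list \<times> nat list" where
  "ttd J = (td (fst J), td (snd J))"

definition omega :: "nat list \<times> nat list \<Rightarrow> int list" where
  "omega \<delta> = map2 (\<lambda>x y. if x \<noteq> 0 then - int x else int y) (fst \<delta>) (snd \<delta>)"

text \<open>
  Only words with distinct letters are inserted below, so the treatment of equal letters is
  irrelevant.
\<close>

fun bst_insert :: "nat \<Rightarrow> nat tree \<Rightarrow> nat tree" where
  "bst_insert x Leaf = Node Leaf x Leaf"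
| "bst_insert x (Node l a r) =
     (if x < a then Node (bst_insert x l) a r else Node l a (bst_insert x r))"

definition shape_of :: "nat tree \<Rightarrow> shape" where
  "shape_of t = map_tree (\<lambda>_. ()) t"

text \<open>\<^const>\<open>fold\<close> inserts the letters from left to right, \<^const>\<open>foldr\<close> from right to left.\<close>

definition P_symbol :: "nat list \<Rightarrow> shape \<times> shape" where
  "P_symbol \<sigma> = (shape_of (fold bst_insert \<sigma> Leaf), shape_of (foldr bst_insert \<sigma> Leaf))"

abbreviation perms :: "nat \<Rightarrow> nat list set" where
  "perms n \<equiv> permutations_of_set {1..n}"

definition permutohedron_covers :: "nat list \<Rightarrow> nat list \<Rightarrow> bool" where
  "permutohedron_covers \<sigma> \<nu> \<longleftrightarrow>
     (\<exists>u a b v. a < b \<and> \<sigma> = u @ [a, b] @ v \<and> \<nu> = u @ [b, a] @ v)"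

definition permutohedron_le :: "nat \<Rightarrow> nat list \<Rightarrow> nat list \<Rightarrow> bool" where
  "permutohedron_le n \<sigma> \<nu> \<longleftrightarrow>
     \<sigma> \<in> perms n \<and> \<nu> \<in> perms n \<and> permutohedron_covers\<^sup>*\<^sup>* \<sigma> \<nu>"

definition baxter_le :: "nat \<Rightarrow> shape \<times> shape \<Rightarrow> shape \<times> shape \<Rightarrow> bool" where
  "baxter_le n J\<^sub>0 J\<^sub>1 \<longleftrightarrow>
     (\<exists>\<sigma> \<nu>. permutohedron_le n \<sigma> \<nu> \<and> P_symbol \<sigma> = J\<^sub>0 \<and> P_symbol \<nu> = J\<^sub>1)"

end

theory Submission
  imports Defs
begin

text \<open>
  In a binary search tree built from a permutation \<open>\<sigma>\<close> read from left to right, the right subtree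
  of \<open>i\<close> consists of the longest run \<open>i + 1, i + 2, \<dots>\<close> of letters that stand after \<open>i\<close> in \<open>\<sigma>\<close>;
  reading from right to left replaces ``after'' by ``before''. Hence the \<open>i\<close>-th letter of
  \<open>\<omega>\<close> only depends on which letters above \<open>i\<close> stand before \<open>i\<close>, and monotonically so, while the
  permutohedron order is inclusion of inversion sets. Conversely, permutations
  \<open>\<sigma> \<le> \<nu>\<close> with prescribed \<open>\<omega>\<close> are built simultaneously by inserting the letters
  \<open>n, n - 1, \<dots>, 1\<close>: each new letter goes as far left as possible into \<open>\<sigma>\<close> and as far right as
  possible into \<open>\<nu>\<close>. The nesting of the subtrees makes both insertions possible, and
  the inequality between the \<open>i\<close>-th letters of \<open>\<omega>\<close> keeps the inversion sets nested.
\<close>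

section \<open>Relative positions in a word\<close>

text \<open>On distinct letters this is a strict total order. Recursion instead of positions lets it
  pass through \<open>@\<close>, \<open>rev\<close> and \<open>filter\<close>.\<close>

fun before :: "'a list \<Rightarrow> 'a \<Rightarrow> 'a \<Rightarrow> bool" where
  "before [] x y \<longleftrightarrow> False"
| "before (z # zs) x y \<longleftrightarrow> x = z \<and> y \<in> set zs \<or> before zs x y"

lemma before_in_set: "before xs x y \<Longrightarrow> x \<in> set xs \<and> y \<in> set xs"
  by (induction xs) auto

lemma before_append:
  "before (xs @ ys) x y \<longleftrightarrow> before xs x y \<or> before ys x y \<or> x \<in> set xs \<and> y \<in> set ys"
  by (induction xs) auto

lemma before_rev [simp]: "before (rev xs) x y \<longleftrightarrow> before xs y x"
  by (induction xs) (auto simp: before_append)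

lemma before_filter: "before (filter P xs) x y \<longleftrightarrow> before xs x y \<and> P x \<and> P y"
  by (induction xs) (auto dest: before_in_set)

lemma before_total:
  "x \<in> set xs \<Longrightarrow> y \<in> set xs \<Longrightarrow> x \<noteq> y \<Longrightarrow> before xs x y \<or> before xs y x"
  by (induction xs) auto

lemma before_asym: "distinct xs \<Longrightarrow> before xs x y \<Longrightarrow> \<not> before xs y x"
  by (induction xs) (auto dest: before_in_set)

lemma before_irrefl: "distinct xs \<Longrightarrow> \<not> before xs x x"
  using before_asym by metis

lemma before_trans: "distinct xs \<Longrightarrow> before xs x y \<Longrightarrow> before xs y z \<Longrightarrow> before xs x z"
  by (induction xs) (auto dest: before_in_set)

text \<open>The longest prefix inside \<open>U\<close> works: the letter that stops it is outside
  \<open>U\<close>, and by down-closedness so is every later one.\<close>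

lemma split_at_down_closed:
  assumes "U \<subseteq> set xs"
    and "\<And>x y. before xs x y \<Longrightarrow> y \<in> U \<Longrightarrow> x \<in> U"
  obtains us vs where "xs = us @ vs" "set us = U" "set vs \<inter> U = {}"
proof
  let ?us = "takeWhile (\<lambda>x. x \<in> U) xs" and ?vs = "dropWhile (\<lambda>x. x \<in> U) xs"
  show eq: "xs = ?us @ ?vs" by simp
  show disj: "set ?vs \<inter> U = {}"
  proof (cases ?vs)
    case (Cons z zs)
    then have "z \<notin> U" by (metis hd_dropWhile list.sel(1) list.simps(3))
    moreover have "before xs z y" if "y \<in> set zs" for y
      by (subst eq) (auto simp: before_append Cons that simp del: takeWhile_dropWhile_id)
    ultimately show ?thesis using assms(2) Cons by auto
  next
    case Nil
    show ?thesis unfolding Nil by simp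
  qed
  have "set xs = set ?us \<union> set ?vs" using eq by (metis set_append)
  then show "set ?us = U" using disj assms(1) by (auto dest: set_takeWhileD)
qed

text \<open>With \<open>i\<close> placed right behind the prefix on \<open>U\<close>, choosing a
  position for \<open>i\<close> amounts to choosing a down-closed set.\<close>

lemma insert_letter:
  assumes "distinct xs" "i \<notin> set xs" "U \<subseteq> set xs"
    and "\<And>x y. before xs x y \<Longrightarrow> y \<in> U \<Longrightarrow> x \<in> U"
  obtains ys where "distinct ys" "set ys = insert i (set xs)"
    "\<And>x y. x \<noteq> i \<Longrightarrow> y \<noteq> i \<Longrightarrow> before ys x y \<longleftrightarrow> before xs x y"
    "\<And>x. before ys x i \<longleftrightarrow> x \<in> U"
    "\<And>x. before ys i x \<longleftrightarrow> x \<in> set xs - U"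
proof -
  obtain us vs where "xs = us @ vs" "set us = U" "set vs \<inter> U = {}"
    using split_at_down_closed assms(3,4) by metis
  then show thesis
    using assms(1,2) by (intro that[of "us @ i # vs"]) (auto simp: before_append dest: before_in_set)
qed

section \<open>The permutohedron order and inversions\<close>

definition inversions_le :: "'a::linorder list \<Rightarrow> 'a list \<Rightarrow> bool" where
  "inversions_le xs ys \<longleftrightarrow> (\<forall>a b. a < b \<longrightarrow> before xs b a \<longrightarrow> before ys b a)"

lemma permutohedron_covers_inversions_le:
  "permutohedron_covers xs ys \<Longrightarrow> inversions_le xs ys"
  by (auto simp: permutohedron_covers_def inversions_le_def before_append)

lemma permutohedron_rtranclp_inversions_le:
  assumes "permutohedron_covers\<^sup>*\<^sup>* xs ys"
  shows "inversions_le xs ys"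
  using assms
proof induction
  case (step ys zs)
  then show ?case
    using permutohedron_covers_inversions_le[of ys zs] by (simp add: inversions_le_def)
qed (simp add: inversions_le_def)

lemma permutohedron_covers_Cons:
  "permutohedron_covers xs ys \<Longrightarrow> permutohedron_covers (x # xs) (x # ys)"
  unfolding permutohedron_covers_def by (metis append_Cons)

lemma permutohedron_rtranclp_Cons:
  "permutohedron_covers\<^sup>*\<^sup>* xs ys \<Longrightarrow> permutohedron_covers\<^sup>*\<^sup>* (x # xs) (x # ys)"
  by (induction rule: rtranclp_induct)
    (auto intro: rtranclp.rtrancl_into_rtrancl permutohedron_covers_Cons)

lemma permutohedron_move_to_front:
  "(\<And>x. x \<in> set us \<Longrightarrow> x < y) \<Longrightarrow> permutohedron_covers\<^sup>*\<^sup>* (us @ y # ws) (y # us @ ws)"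
proof (induction us)
  case (Cons u us)
  then have "permutohedron_covers\<^sup>*\<^sup>* (u # us @ y # ws) (u # y # us @ ws)"
    by (intro permutohedron_rtranclp_Cons) simp
  moreover have "permutohedron_covers (u # y # us @ ws) (y # u # us @ ws)"
    unfolding permutohedron_covers_def
    using Cons.prems by (intro exI[of _ "[]"] exI[of _ u] exI[of _ y] exI[of _ "us @ ws"]) simp
  ultimately show ?case by simp
qed simp

text \<open>Letters standing in \<open>xs\<close> before the first letter \<open>y\<close> of the
  target are smaller than \<open>y\<close>, as a larger one would form an inversion the target
  lacks. So covers carry \<open>y\<close> to the front, and induction treats the rest.\<close>

lemma inversions_le_permutohedron:
  assumes "distinct xs" "distinct ys" "set xs = set ys" "inversions_le xs ys"
  shows "permutohedron_covers\<^sup>*\<^sup>* xs ys"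
  using assms
proof (induction ys arbitrary: xs)
  case (Cons y ys)
  then obtain us ws where xs: "xs = us @ y # ws"
    by (metis list.set_intros(1) split_list)
  have smaller: "x < y" if "x \<in> set us" for x
  proof (rule ccontr)
    assume "\<not> x < y"
    moreover have "x \<noteq> y" using that xs Cons.prems(1) by auto
    ultimately have "y < x" by simp
    moreover have "before xs x y" using that xs by (auto simp: before_append)
    ultimately have "before (y # ys) x y"
      using Cons.prems(4) by (auto simp: inversions_le_def)
    then show False using Cons.prems(2) \<open>x \<noteq> y\<close> by (auto dest: before_in_set)
  qed
  have "inversions_le (us @ ws) ys"
    unfolding inversions_le_def
  proof (intro allI impI)
    fix a b assume "a < b" and b: "before (us @ ws) b a"
    then have "before xs b a" by (auto simp: xs before_append)
    then have "before (y # ys) b a" using \<open>a < b\<close> Cons.prems(4) by (auto simp: inversions_le_def)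
    moreover have "b \<noteq> y" using before_in_set[OF b] Cons.prems(1) xs by auto
    ultimately show "before ys b a" by simp
  qed
  moreover have "set (us @ ws) = set ys"
    using Cons.prems(1-3) by (auto simp: xs)
  ultimately have "permutohedron_covers\<^sup>*\<^sup>* (us @ ws) ys"
    using Cons.prems(1,2) by (intro Cons.IH) (auto simp: xs)
  then show ?case
    using permutohedron_move_to_front[OF smaller, of us ws] permutohedron_rtranclp_Cons xs
    by (metis rtranclp_trans)
qed simp

section \<open>Runs of letters and Tamari diagrams\<close>

text \<open>A relation on \<open>d\<close>, so that a prescribed diagram can be compared with that
  of a constructed tree. The bounds are parameters because subtrees live on subintervals and the
  insertion argument lowers \<open>m\<close>. The last clause is maximality, guarded since a run may
  also stop at the last letter.\<close>

definition runs :: "nat list \<Rightarrow> (nat \<Rightarrow> nat) \<Rightarrow> nat \<Rightarrow> nat \<Rightarrow> bool" where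
  "runs xs d m n \<longleftrightarrow> (\<forall>i. m \<le> i \<and> i < n \<longrightarrow> i + d i < n \<and>
     (\<forall>j. i < j \<and> j \<le> i + d i \<longrightarrow> before xs i j) \<and>
     (Suc (i + d i) < n \<longrightarrow> \<not> before xs i (Suc (i + d i))))"

lemma runs_less: "runs xs d m n \<Longrightarrow> m \<le> i \<Longrightarrow> i < n \<Longrightarrow> i + d i < n"
  by (simp add: runs_def)

lemma runs_before: "runs xs d m n \<Longrightarrow> m \<le> i \<Longrightarrow> i < j \<Longrightarrow> j \<le> i + d i \<Longrightarrow> i < n \<Longrightarrow> before xs i j"
  by (simp add: runs_def)

lemma runs_end:
  "runs xs d m n \<Longrightarrow> m \<le> i \<Longrightarrow> Suc (i + d i) < n \<Longrightarrow> \<not> before xs i (Suc (i + d i))"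
  by (simp add: runs_def)

text \<open>If \<open>d' i\<close> were smaller, the letter ending its run would lie inside the run
  given by \<open>d\<close>.\<close>

lemma runs_le:
  assumes "runs xs d m n" "runs xs d' m n" "m \<le> i" "i < n"
  shows "d i \<le> d' i"
proof (rule ccontr)
  assume "\<not> d i \<le> d' i"
  then show False
    using runs_less[OF assms(1,3,4)] runs_before[OF assms(1,3), of "Suc (i + d' i)"]
      runs_end[OF assms(2,3)] assms(4) by simp
qed

lemma runs_unique:
  "runs xs d m n \<Longrightarrow> runs xs d' m n \<Longrightarrow> m \<le> i \<Longrightarrow> i < n \<Longrightarrow> d i = d' i"
  using runs_le by (metis le_antisym)

text \<open>The classical condition on Tamari diagrams: the intervals from \<open>i\<close> to
  \<open>i + d i\<close> are pairwise nested or disjoint.\<close>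

definition tamari :: "(nat \<Rightarrow> nat) \<Rightarrow> nat \<Rightarrow> nat \<Rightarrow> bool" where
  "tamari d m n \<longleftrightarrow> (\<forall>i. m \<le> i \<and> i < n \<longrightarrow> i + d i < n \<and>
     (\<forall>j. i < j \<and> j \<le> i + d i \<longrightarrow> j + d j \<le> i + d i))"

lemma length_td [simp]: "length (td t) = size t"
  by (induction t) auto

lemma td_less: "i < size t \<Longrightarrow> i + td t ! i < size t"
proof (induction t arbitrary: i)
  case (Node l x r)
  consider "i < size l" | "i = size l" | k where "i = Suc (size l + k)"
    by (metis less_imp_Suc_add not_less_iff_gr_or_eq)
  then show ?case
  proof cases
    case 1
    then show ?thesis using Node.IH(1)[of i] by (simp add: nth_append)
  next
    case 3
    then show ?thesis using Node.IH(2)[of k] Node.prems by (simp add: nth_append)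
  qed (simp add: nth_append)
qed simp

text \<open>Inorder lists node \<open>i\<close> directly followed by its right subtree, so this is
  containment of right subtrees.\<close>

lemma td_nested: "i < j \<Longrightarrow> j \<le> i + td t ! i \<Longrightarrow> i < size t \<Longrightarrow> j + td t ! j \<le> i + td t ! i"
proof (induction t arbitrary: i j)
  case (Node l x r)
  consider "i < size l" | "i = size l" | k where "i = Suc (size l + k)"
    by (metis less_imp_Suc_add not_less_iff_gr_or_eq)
  then show ?case
  proof cases
    case 1
    then have "i + td l ! i < size l" by (rule td_less)
    then show ?thesis using 1 Node.IH(1)[of i j] Node.prems by (simp add: nth_append)
  next
    case 2
    then obtain q where q: "j = Suc (size l + q)"
      using Node.prems(1) by (metis less_imp_Suc_add)
    then have "q < size r" using 2 Node.prems(2) by (simp add: nth_append)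
    then show ?thesis using 2 q td_less[of q r] by (simp add: nth_append)
  next
    case 3
    then obtain q where q: "j = Suc (size l + q)"
      using Node.prems(1) by (metis less_imp_Suc_add add_Suc_right add.assoc)
    then show ?thesis using 3 Node.IH(2)[of k q] Node.prems by (simp add: nth_append)
  qed
qed simp

lemma tamari_td: "tamari (\<lambda>i. td t ! (i - m)) m (m + size t)"
  unfolding tamari_def
proof (intro allI impI conjI)
  fix i assume "m \<le> i \<and> i < m + size t"
  then obtain k where k: "i = m + k" "k < size t"
    by (metis le_iff_add nat_add_left_cancel_less)
  then show "i + td t ! (i - m) < m + size t" using td_less[of k t] by simp
  fix j assume "i < j \<and> j \<le> i + td t ! (i - m)"
  moreover from this obtain q where "j = m + q"
    using k by (metis le_iff_add less_imp_le_nat le_trans)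
  ultimately show "j + td t ! (j - m) \<le> i + td t ! (i - m)"
    using k td_nested[of k q t] by simp
qed

lemma td_inject:
  fixes s t :: shape
  shows "td s = td t \<Longrightarrow> s = t"
proof (induction s arbitrary: t)
  case Leaf
  then show ?case by (cases t) auto
next
  case (Node l x r)
  then obtain l' x' r' where t: "t = Node l' x' r'" by (cases t) auto
  have eq: "td l @ size r # td r = td l' @ size r' # td r'"
    using Node.prems t by simp
  then have "length (td l @ size r # td r) = length (td l' @ size r' # td r')"
    by (rule arg_cong)
  then have sz: "size l + size r = size l' + size r'" by simp
  \<comment> \<open>The root is the first node whose right subtree reaches the end of the word.\<close>
  have "\<not> size l < size l'"
  proof
    assume "size l < size l'"
    then have "td l' ! size l = size r"
      using arg_cong[OF eq, of "\<lambda>w. w ! size l"] by (simp add: nth_append)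
    then show False using td_less[OF \<open>size l < size l'\<close>] sz by simp
  qed
  moreover have "\<not> size l' < size l"
  proof
    assume "size l' < size l"
    then have "td l ! size l' = size r'"
      using arg_cong[OF eq, of "\<lambda>w. w ! size l'"] by (simp add: nth_append)
    then show False using td_less[OF \<open>size l' < size l\<close>] sz by simp
  qed
  ultimately have "td l = td l' \<and> td r = td r'"
    using eq by (simp add: append_eq_append_conv)
  then show ?case using Node.IH t by simp
qed

section \<open>Tamari diagrams of binary search trees\<close>

lemma fold_bst_insert_Node:
  "fold bst_insert xs (Node l a r) =
     Node (fold bst_insert (filter (\<lambda>x. x < a) xs) l) a
          (fold bst_insert (filter (\<lambda>x. \<not> x < a) xs) r)"
proof (induction xs arbitrary: l r)
  case (Cons x xs)
  then show ?case by (cases "x < a") simp_all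
qed simp

lemma size_shape_of [simp]: "size (shape_of t) = size t"
  by (simp add: shape_of_def)

lemma size_bst_insert [simp]: "size (bst_insert x t) = Suc (size t)"
  by (induction t) simp_all

lemma size_fold_bst_insert [simp]: "size (fold bst_insert xs t) = length xs + size t"
  by (induction xs arbitrary: t) simp_all

text \<open>The first letter \<open>a\<close> is the root and precedes all larger letters, so its
  run reaches the end. The other runs are those of the subwords of letters below and above
  \<open>a\<close>, which build the two subtrees.\<close>

lemma runs_bst:
  assumes "distinct xs" "set xs = {m..<n}"
  shows "runs xs (\<lambda>i. td (shape_of (fold bst_insert xs Leaf)) ! (i - m)) m n"
  using assms
proof (induction "length xs" arbitrary: xs m n rule: less_induct)
  case less
  show ?case
  proof (cases xs)
    case Nil
    then show ?thesis using less.prems by (auto simp: runs_def)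
  next
    case (Cons a as)
    let ?l = "filter (\<lambda>x. x < a) as" and ?r = "filter (\<lambda>x. \<not> x < a) as"
    define tl tr where "tl = shape_of (fold bst_insert ?l Leaf)"
      and "tr = shape_of (fold bst_insert ?r Leaf)"
    have a: "m \<le> a" "a < n" using less.prems(2) Cons by auto
    have as: "distinct as" "set as = {m..<n} - {a}" using less.prems Cons by auto
    have setl: "set ?l = {m..<a}" and setr: "set ?r = {Suc a..<n}"
      unfolding set_filter as(2) using a by auto
    have IHl: "runs ?l (\<lambda>i. td tl ! (i - m)) m a"
      unfolding tl_def
      by (rule less.hyps[OF _ _ setl]) (simp_all add: Cons as(1) le_imp_less_Suc)
    have IHr: "runs ?r (\<lambda>i. td tr ! (i - Suc a)) (Suc a) n"
      unfolding tr_def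
      by (rule less.hyps[OF _ _ setr]) (simp_all add: Cons as(1) le_imp_less_Suc)
    have szl: "size tl = a - m"
      using distinct_card[of ?l] as(1) unfolding setl by (simp add: tl_def)
    have szr: "size tr = n - Suc a"
      using distinct_card[of ?r] as(1) unfolding setr by (simp add: tr_def)
    have "td (shape_of (fold bst_insert xs Leaf)) = td tl @ size tr # td tr"
      by (simp add: Cons fold_bst_insert_Node shape_of_def tl_def tr_def)
    then have td: "td (shape_of (fold bst_insert xs Leaf)) = td tl @ (n - Suc a) # td tr"
      by (simp only: szr)
    show ?thesis
      unfolding td runs_def
    proof (intro allI impI)
      fix i assume i: "m \<le> i \<and> i < n"
      let ?d = "(td tl @ (n - Suc a) # td tr) ! (i - m)"
      consider "i < a" | "i = a" | "a < i" by linarith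
      then show "i + ?d < n \<and> (\<forall>j. i < j \<and> j \<le> i + ?d \<longrightarrow> before xs i j) \<and>
          (Suc (i + ?d) < n \<longrightarrow> \<not> before xs i (Suc (i + ?d)))"
      proof cases
        case 1
        then have d: "?d = td tl ! (i - m)"
          using i szl by (simp add: nth_append diff_less_mono)
        have *: "before xs i j \<longleftrightarrow> before ?l i j" if "j < a" for j
          using 1 that by (simp add: Cons before_filter)
        \<comment> \<open>Since \<open>a\<close> stands first, the run of a smaller letter cannot
          pass \<open>a\<close>.\<close>
        have **: "\<not> before xs i a"
          using 1 as by (auto simp: Cons dest: before_in_set)
        have lt: "i + ?d < a" using runs_less[OF IHl, of i] i 1 d by simp
        have "before xs i j" if "i < j" "j \<le> i + ?d" for j
          using runs_before[OF IHl, of i j] i 1 d that lt * by simp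
        moreover have "\<not> before xs i (Suc (i + ?d))"
          using runs_end[OF IHl, of i] i d lt * ** by (cases "Suc (i + ?d) = a") auto
        ultimately show ?thesis using lt a by simp
      next
        case 2
        then have d: "?d = n - Suc a" using szl by (simp add: nth_append)
        have "before xs a j" if "a < j" "j < n" for j
          using that a as(2) by (simp add: Cons)
        then show ?thesis using a unfolding d unfolding 2 by auto
      next
        case 3
        then have "i - m = size tl + Suc (i - Suc a)"
          using szl a by simp
        then have d: "?d = td tr ! (i - Suc a)"
          by (simp add: nth_append)
        have *: "before xs i j \<longleftrightarrow> before ?r i j" if "a < j" for j
          using 3 that by (auto simp: Cons before_filter)
        show ?thesis
          using runs_less[OF IHr, of i] runs_before[OF IHr, of i] runs_end[OF IHr, of i] i 3 d *
          by auto
      qed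
    qed
  qed
qed

lemma shape_bst_eqI:
  assumes "distinct xs" "set xs = {m..<m + size t}"
    and "runs xs (\<lambda>i. td t ! (i - m)) m (m + size t)"
  shows "shape_of (fold bst_insert xs Leaf) = t"
proof (intro td_inject nth_equalityI)
  have len: "length xs = size t" using distinct_card[OF assms(1)] assms(2) by simp
  then show "length (td (shape_of (fold bst_insert xs Leaf))) = length (td t)" by simp
  fix i assume "i < length (td (shape_of (fold bst_insert xs Leaf)))"
  then show "td (shape_of (fold bst_insert xs Leaf)) ! i = td t ! i"
    using runs_unique[OF runs_bst[OF assms(1,2)] assms(3), of "m + i"] len by simp
qed

text \<open>Right-to-left insertion is left-to-right insertion of \<open>rev xs\<close>, so the
  second tree measures runs of letters standing before \<open>i\<close>.\<close>

lemma P_symbol_eq_iff: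
  assumes "xs \<in> perms n" "size (fst J) = n" "size (snd J) = n"
  shows "P_symbol xs = J \<longleftrightarrow>
    runs xs (\<lambda>i. td (fst J) ! (i - 1)) 1 (Suc n) \<and>
    runs (rev xs) (\<lambda>i. td (snd J) ! (i - 1)) 1 (Suc n)"
proof -
  have xs: "distinct xs" "set xs = {1..<Suc n}"
    using assms(1) by (simp_all add: permutations_of_set_def atLeastLessThanSuc_atLeastAtMost)
  have "P_symbol xs =
      (shape_of (fold bst_insert xs Leaf), shape_of (fold bst_insert (rev xs) Leaf))"
    by (simp add: P_symbol_def foldr_conv_fold)
  then show ?thesis
    using runs_bst[OF xs] runs_bst[of "rev xs" 1 "Suc n"] xs assms(2,3)
      shape_bst_eqI[of xs 1 "fst J"] shape_bst_eqI[of "rev xs" 1 "snd J"]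
    by (cases J) auto
qed

section \<open>Canopies\<close>

lemma length_leaf_word [simp]: "length (leaf_word b t) = Suc (size t)"
  by (induction b t rule: leaf_word.induct) auto

lemma leaf_word_nth_0: "leaf_word b t ! 0 = (if t = Leaf then b else 1)"
  by (induction b t rule: leaf_word.induct) (auto simp: nth_append)

text \<open>Leaf \<open>Suc i\<close> directly follows node \<open>i\<close> in inorder. It is the
  right child of that node if the right subtree is empty, and otherwise the leftmost leaf of that
  subtree, hence a left child.\<close>

lemma leaf_word_nth_Suc: "i < size t \<Longrightarrow> leaf_word b t ! Suc i = (if td t ! i = 0 then 0 else 1)"
proof (induction b t arbitrary: i rule: leaf_word.induct)
  case (2 b l x r)
  consider "i < size l" | "i = size l" | k where "i = Suc (size l + k)"
    by (metis less_imp_Suc_add not_less_iff_gr_or_eq)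
  then show ?case
    using 2 by cases (auto simp: nth_append leaf_word_nth_0)
qed simp

lemma canopy_nth: "i < size t - 1 \<Longrightarrow> canopy t ! i = (if td t ! i = 0 then 0 else 1)"
  using leaf_word_nth_Suc[of i t 0] by (simp add: canopy_def nth_butlast nth_tl)

text \<open>The bound \<open>i < n\<close> matters: the last inorder node has no right subtree, so
  both letters vanish at \<open>n\<close>.\<close>

lemma twin_trees_td:
  assumes "twin_trees n J" "1 \<le> i" "i < n"
  shows "(td (fst J) ! (i - 1) = 0) \<noteq> (td (snd J) ! (i - 1) = 0)"
proof -
  have "i - 1 < n - 1" using assms by simp
  then show ?thesis
    using assms(1) canopy_nth[of "i - 1"] by (auto simp: twin_trees_def split: if_splits)
qed

lemma omega_nth:
  assumes "i < size (fst J)" "i < size (snd J)"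
  shows "omega (ttd J) ! i =
    (if td (fst J) ! i \<noteq> 0 then - int (td (fst J) ! i) else int (td (snd J) ! i))"
  using assms by (simp add: omega_def ttd_def)

section \<open>Inserting the next smaller letter\<close>

text \<open>By nesting, the letter \<open>k\<close> ending the run of \<open>j\<close> is at most
  \<open>c\<close>, and by maximality it stands before \<open>j\<close>. Either
  \<open>k = c\<close>, or \<open>k\<close> is a larger letter of the same range and induction puts
  \<open>c\<close> before \<open>k\<close>.\<close>

lemma run_end_before:
  assumes xs: "distinct xs" "set xs = {Suc m..<n}"
    and runs: "runs xs d (Suc m) n" and tamari: "tamari d m n"
    and c: "c = Suc (m + d m)" "c < n"
    and j: "m < j" "j \<le> m + d m"
  shows "before xs c j"
  using j
proof (induction "n - j" arbitrary: j rule: less_induct)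
  case less
  let ?k = "Suc (j + d j)"
  have "j + d j \<le> m + d m"
    using tamari less.prems c by (auto simp: tamari_def)
  then have k: "?k \<le> c" "?k < n" "?k \<in> set xs" "j \<in> set xs"
    using c xs(2) less.prems by auto
  have kj: "before xs ?k j"
    using runs_end[OF runs, of j] before_total[OF k(3,4)] k less.prems by auto
  show ?case
  proof (cases "?k = c")
    case True
    with kj show ?thesis by simp
  next
    case False
    then have "before xs c ?k"
      using less.hyps[of ?k] less.prems k c by auto
    with kj show ?thesis using before_trans[OF xs(1)] by blast
  qed
qed

text \<open>The condition on the P-symbol without trees, meaningful for partial words on the letters
  from \<open>m\<close> on.\<close>

definition twin_runs :: "nat list \<Rightarrow> (nat \<Rightarrow> nat) \<Rightarrow> (nat \<Rightarrow> nat) \<Rightarrow> nat \<Rightarrow> nat \<Rightarrow> bool" where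
  "twin_runs xs L R m n \<longleftrightarrow>
     distinct xs \<and> set xs = {m..<n} \<and> runs xs L m n \<and> runs (rev xs) R m n"

lemma twin_runs_rev: "twin_runs (rev xs) R L m n \<longleftrightarrow> twin_runs xs L R m n"
  by (auto simp: twin_runs_def)

text \<open>
  The letters that \<open>L m\<close> and \<open>R m\<close> require before \<open>m\<close>. Inserting \<open>m\<close> directly after the last
  of them is the leftmost choice; reversing the word and swapping \<open>L\<close> with \<open>R\<close> gives the
  rightmost one.
\<close>

definition forced :: "(nat \<Rightarrow> nat) \<Rightarrow> (nat \<Rightarrow> nat) \<Rightarrow> nat \<Rightarrow> nat \<Rightarrow> nat set" where
  "forced L R m n = (if L m \<noteq> 0 then {Suc (m + L m)} \<inter> {..<n} else {m<..m + R m})"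

text \<open>The letters before \<open>m\<close> are the down-closure \<open>U\<close> of the forced
  ones. Nesting, through \<open>run_end_before\<close>, keeps \<open>U\<close> away from the letters
  that must follow \<open>m\<close>.\<close>

lemma insert_next_letter:
  assumes twin_runs: "twin_runs xs L R (Suc m) n" and "m < n"
    and tamari: "tamari L m n" "tamari R m n"
    and twin: "Suc m < n \<Longrightarrow> (L m = 0) \<noteq> (R m = 0)"
  obtains ys where "twin_runs ys L R m n"
    "\<And>x y. m < x \<Longrightarrow> m < y \<Longrightarrow> before ys x y \<longleftrightarrow> before xs x y"
    "\<And>x. before ys x m \<longleftrightarrow> (\<exists>y \<in> forced L R m n. x = y \<or> before xs x y)"
proof -
  have xs: "distinct xs" "set xs = {Suc m..<n}"
    and L: "runs xs L (Suc m) n" and R: "runs (rev xs) R (Suc m) n"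
    using twin_runs by (auto simp: twin_runs_def)
  define U where "U = {x. \<exists>y \<in> forced L R m n. x = y \<or> before xs x y}"
  have less: "m + L m < n" "m + R m < n"
    using tamari \<open>m < n\<close> by (auto simp: tamari_def)
  have "forced L R m n \<subseteq> set xs"
    unfolding forced_def xs(2) using less by auto
  then have U: "U \<subseteq> set xs" unfolding U_def using before_in_set by fast
  have down: "x \<in> U" if "before xs x y" "y \<in> U" for x y
    using that before_trans[OF xs(1)] unfolding U_def by blast
  have "m \<notin> set xs" using xs(2) by simp
  then obtain ys where ys: "distinct ys" "set ys = insert m (set xs)"
    and old: "\<And>x y. x \<noteq> m \<Longrightarrow> y \<noteq> m \<Longrightarrow> before ys x y \<longleftrightarrow> before xs x y"
    and new: "\<And>x. before ys x m \<longleftrightarrow> x \<in> U" "\<And>x. before ys m x \<longleftrightarrow> x \<in> set xs - U"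
    using insert_letter[OF xs(1) \<open>m \<notin> set xs\<close> U] down by metis
  note end_before = run_end_before[OF xs L tamari(1) refl]
  \<comment> \<open>For the reversed word: the letter ending the prescribed \<open>R\<close>-run of
    \<open>m\<close> stands after that whole run.\<close>
  note end_after = run_end_before[of "rev xs", simplified, OF xs R tamari(2) refl]
  \<comment> \<open>These are the conditions on \<open>U\<close> that give \<open>m\<close> both
    prescribed runs.\<close>
  have *: "(\<forall>j. m < j \<and> j \<le> m + L m \<longrightarrow> j \<notin> U) \<and> (Suc (m + L m) < n \<longrightarrow> Suc (m + L m) \<in> U) \<and>
      (\<forall>j. m < j \<and> j \<le> m + R m \<longrightarrow> j \<in> U) \<and> (Suc (m + R m) < n \<longrightarrow> Suc (m + R m) \<notin> U)"
  proof (cases "L m = 0")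
    case False
    then have U_eq: "U = {x. Suc (m + L m) < n \<and> (x = Suc (m + L m) \<or> before xs x (Suc (m + L m)))}"
      by (auto simp: U_def forced_def)
    have "j \<notin> U" if "m < j" "j \<le> m + L m" for j
      using that end_before[of j] before_asym[OF xs(1)] by (auto simp: U_eq)
    \<comment> \<open>A nonzero \<open>L m\<close> forces \<open>Suc m < n\<close>, so
      \<open>twin\<close> applies.\<close>
    moreover have "R m = 0" using twin False less by auto
    ultimately show ?thesis using False by (auto simp: U_eq)
  next
    case True
    then have U_eq: "U = {x. \<exists>y. m < y \<and> y \<le> m + R m \<and> (x = y \<or> before xs x y)}"
      by (auto simp: U_def forced_def)
    have "Suc (m + R m) \<notin> U" if "Suc (m + R m) < n"
      using that end_after before_asym[OF xs(1)] by (fastforce simp: U_eq)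
    moreover have "Suc m \<in> U" if "Suc m < n"
      using twin that True by (auto simp: U_eq)
    ultimately show ?thesis using True by (auto simp: U_eq)
  qed
  have "runs ys L m n"
    unfolding runs_def
  proof (intro allI impI)
    fix i assume i: "m \<le> i \<and> i < n"
    show "i + L i < n \<and> (\<forall>j. i < j \<and> j \<le> i + L i \<longrightarrow> before ys i j) \<and>
        (Suc (i + L i) < n \<longrightarrow> \<not> before ys i (Suc (i + L i)))"
    proof (cases "i = m")
      case True
      then show ?thesis using * less xs(2) by (auto simp: new)
    next
      case False
      then show ?thesis
        using i runs_less[OF L, of i] runs_before[OF L, of i] runs_end[OF L, of i]
        by (auto simp: old)
    qed
  qed
  moreover have "runs (rev ys) R m n"
    unfolding runs_def
  proof (intro allI impI)
    fix i assume i: "m \<le> i \<and> i < n"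
    show "i + R i < n \<and> (\<forall>j. i < j \<and> j \<le> i + R i \<longrightarrow> before (rev ys) i j) \<and>
        (Suc (i + R i) < n \<longrightarrow> \<not> before (rev ys) i (Suc (i + R i)))"
    proof (cases "i = m")
      case True
      then show ?thesis using * less by (auto simp: new)
    next
      case False
      then show ?thesis
        using i runs_less[OF R, of i] runs_before[OF R, of i] runs_end[OF R, of i]
        by (auto simp: old)
    qed
  qed
  moreover have "set ys = {m..<n}" using ys(2) xs(2) \<open>m < n\<close> by auto
  ultimately have "twin_runs ys L R m n" using ys(1) by (simp add: twin_runs_def)
  then show thesis using that old new(1) by (simp add: U_def)
qed

text \<open>As \<open>m\<close> is the smallest letter, the only new inversions are larger letters
  before \<open>m\<close>. It remains to see that no letter is weakly left of one forced before
  \<open>m\<close> in \<open>xs\<close> and weakly right of one forced after \<open>m\<close> in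
  \<open>ys\<close>.\<close>

lemma insert_next_letter_pair:
  assumes xs: "twin_runs xs L0 R0 (Suc m) n" and ys: "twin_runs ys L1 R1 (Suc m) n"
    and inv: "inversions_le xs ys" and "m < n"
    and tamari: "tamari L0 m n" "tamari R0 m n" "tamari L1 m n" "tamari R1 m n"
    and twin: "Suc m < n \<Longrightarrow> (L0 m = 0) \<noteq> (R0 m = 0)" "Suc m < n \<Longrightarrow> (L1 m = 0) \<noteq> (R1 m = 0)"
    and le: "(if L0 m \<noteq> 0 then - int (L0 m) else int (R0 m)) \<le>
      (if L1 m \<noteq> 0 then - int (L1 m) else int (R1 m))"
  obtains xs' ys' where "twin_runs xs' L0 R0 m n" "twin_runs ys' L1 R1 m n" "inversions_le xs' ys'"
proof -
  obtain xs' where xs': "twin_runs xs' L0 R0 m n"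
    and old_xs: "\<And>x y. m < x \<Longrightarrow> m < y \<Longrightarrow> before xs' x y \<longleftrightarrow> before xs x y"
    and new_xs: "\<And>x. before xs' x m \<longleftrightarrow> (\<exists>y \<in> forced L0 R0 m n. x = y \<or> before xs x y)"
    by (rule insert_next_letter[OF xs \<open>m < n\<close> tamari(1,2)]; rule twin(1) that)
  obtain zs where zs: "twin_runs zs R1 L1 m n"
    and old_zs: "\<And>x y. m < x \<Longrightarrow> m < y \<Longrightarrow> before zs x y \<longleftrightarrow> before (rev ys) x y"
    and new_zs: "\<And>x. before zs x m \<longleftrightarrow> (\<exists>y \<in> forced R1 L1 m n. x = y \<or> before (rev ys) x y)"
    by (rule insert_next_letter[OF twin_runs_rev[THEN iffD2, OF ys] \<open>m < n\<close> tamari(4,3)];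
        rule twin(2)[symmetric] that)
  have dx: "distinct xs" and sx: "set xs = {Suc m..<n}" and rL0: "runs xs L0 (Suc m) n"
    using xs by (auto simp: twin_runs_def)
  have dy: "distinct ys" and sy: "set ys = {Suc m..<n}" and rR1: "runs (rev ys) R1 (Suc m) n"
    using ys by (auto simp: twin_runs_def)
  have mono: "before ys b a" if "before xs b a" "a < b" for a b
    using inv that by (auto simp: inversions_le_def)
  note trans = before_trans[OF dy] and irrefl = before_irrefl[OF dy]
  note end0 = run_end_before[OF dx sx rL0 tamari(1) refl]
  note end1 = run_end_before[of "rev ys", simplified, OF dy sy rR1 tamari(4) refl]
  have disjoint: False
    if y: "y \<in> forced L0 R0 m n" "x = y \<or> before xs x y"
      and z: "z \<in> forced R1 L1 m n" "x = z \<or> before ys z x" for x y z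
  proof (cases "L0 m = 0")
    case False
    then have y_eq: "y = Suc (m + L0 m)" "y < n" using y by (auto simp: forced_def)
    have y_before: "before xs y j" if "m < j" "j \<le> m + L0 m" for j
      using end0[of j] that y_eq by simp
    \<comment> \<open>The letter \<open>y\<close> precedes the whole \<open>L0\<close>-run in
      \<open>xs\<close>, so a letter before \<open>y\<close> exceeds \<open>y\<close>; this
      inversion persists in \<open>ys\<close>.\<close>
    have "x = y \<or> before ys x y"
    proof (cases "x = y")
      case False
      then have b: "before xs x y" using y by simp
      then have "m < x" using sx before_in_set[OF b] by auto
      then have "y < x" using y_before[of x] b before_asym[OF dx] False y_eq by fastforce
      then show ?thesis using b mono by simp
    qed simp
    then have zy: "z = y \<or> before ys z y" using z(2) trans by blast
    show False
    proof (cases "R1 m = 0")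
      case True
      then have "m < z" "z \<le> m + L1 m" "L1 m \<noteq> 0" using z(1) by (auto simp: forced_def)
      \<comment> \<open>Both letters of \<omega> are negative here, so \<open>le\<close> gives
        \<open>L1 m \<le> L0 m\<close>.\<close>
      then have "z \<le> m + L0 m" using le False by auto
      then have "before ys y z" using y_before[of z] mono \<open>m < z\<close> y_eq by simp
      then show False using zy trans irrefl by blast
    next
      case R1: False
      then have "z = Suc (m + R1 m)" "z < n" using z(1) by (auto simp: forced_def)
      \<comment> \<open>\<open>Suc m\<close> lies in both the \<open>L0\<close>-run and the
        \<open>R1\<close>-run, which puts it between \<open>y\<close> and \<open>z\<close> in
        \<open>ys\<close>.\<close>
      then have "before ys (Suc m) z" using end1[of "Suc m"] R1 by simp
      moreover have "before ys y (Suc m)"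
        using mono y_before[of "Suc m"] False y_eq by simp
      ultimately show False using zy trans irrefl by blast
    qed
  next
    case True
    then have y_le: "m < y" "y \<le> m + R0 m" using y by (auto simp: forced_def)
    \<comment> \<open>A positive letter of \<omega> can only be followed by a positive one, so
      \<open>L1 m = 0\<close>.\<close>
    then have "R1 m \<noteq> 0" "R0 m \<le> R1 m"
      using le True by (auto split: if_splits)
    then have z_eq: "z = Suc (m + R1 m)" "z < n" using z(1) by (auto simp: forced_def)
    have before_z: "before ys j z" if "m < j" "j \<le> m + R0 m" for j
      using end1[of j] that z_eq \<open>R0 m \<le> R1 m\<close> by simp
    have "m < x" using y(2) y_le sx by (auto dest: before_in_set)
    \<comment> \<open>If \<open>x \<le> y\<close>, then \<open>x\<close> is in the
      \<open>R1\<close>-run, which \<open>z\<close> ends; otherwise \<open>x\<close> before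
      \<open>y\<close> is an inversion inherited by \<open>ys\<close>.\<close>
    have "before ys x z"
    proof (cases "x \<le> y")
      case True
      then show ?thesis using before_z[of x] y_le \<open>m < x\<close> by simp
    next
      case False
      then have "before ys x y" using y(2) mono by auto
      then show ?thesis using before_z[OF y_le] trans by blast
    qed
    then show False using z(2) trans irrefl by blast
  qed
  have sz: "set zs = {m..<n}" using zs by (auto simp: twin_runs_def)
  have "inversions_le xs' (rev zs)"
    unfolding inversions_le_def
  proof (intro allI impI)
    fix a b :: nat assume "a < b" and ba: "before xs' b a"
    have ab: "a \<in> {m..<n}" "b \<in> {m..<n}" using before_in_set[OF ba] xs' by (auto simp: twin_runs_def)
    show "before (rev zs) b a"
    proof (cases "a = m")
      case True
      then have "\<not> before zs b m" using ba disjoint by (auto simp: new_xs new_zs)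
      then show ?thesis using before_total[of a zs b] ab sz True \<open>a < b\<close> by auto
    next
      case False
      then have "m < a" "m < b" using ab \<open>a < b\<close> by auto
      then show ?thesis using ba mono \<open>a < b\<close> by (simp add: old_xs old_zs)
    qed
  qed
  moreover have "twin_runs (rev zs) L1 R1 m n" using zs by (simp add: twin_runs_rev)
  ultimately show thesis using that xs' by blast
qed

text \<open>Downward induction from the empty words at \<open>m = n\<close>. The hypotheses depend
  on \<open>m\<close>, so they enter the induction and are restricted at each step.\<close>

lemma ex_twin_runs_pair:
  assumes tamari: "tamari L0 m n" "tamari R0 m n" "tamari L1 m n" "tamari R1 m n"
    and twin: "\<And>i. m \<le> i \<Longrightarrow> Suc i < n \<Longrightarrow> (L0 i = 0) \<noteq> (R0 i = 0)"
      "\<And>i. m \<le> i \<Longrightarrow> Suc i < n \<Longrightarrow> (L1 i = 0) \<noteq> (R1 i = 0)"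
    and le: "\<And>i. m \<le> i \<Longrightarrow> i < n \<Longrightarrow> (if L0 i \<noteq> 0 then - int (L0 i) else int (R0 i)) \<le>
      (if L1 i \<noteq> 0 then - int (L1 i) else int (R1 i))"
    and "m \<le> n"
  shows "\<exists>xs ys. twin_runs xs L0 R0 m n \<and> twin_runs ys L1 R1 m n \<and> inversions_le xs ys"
  using \<open>m \<le> n\<close> assms(1-7)
proof (induction m rule: inc_induct)
  case base
  show ?case
    by (intro exI[of _ "[]"]) (simp add: twin_runs_def runs_def inversions_le_def)
next
  case (step m)
  have sub: "tamari d (Suc m) n" if "tamari d m n" for d using that by (simp add: tamari_def)
  have "\<exists>xs ys. twin_runs xs L0 R0 (Suc m) n \<and> twin_runs ys L1 R1 (Suc m) n \<and> inversions_le xs ys"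
    by (rule step.IH; (rule sub)?; (rule step.prems; simp))
  then obtain xs ys where
    "twin_runs xs L0 R0 (Suc m) n" "twin_runs ys L1 R1 (Suc m) n" "inversions_le xs ys"
    by blast
  then show ?case
    using insert_next_letter_pair[of xs L0 R0 m n ys L1 R1] step.prems step.hyps
    by (metis le_refl)
qed

text \<open>More inversions mean fewer larger letters after \<open>i\<close> and more before it:
  \<open>L\<close>-runs shrink and \<open>R\<close>-runs grow.\<close>

lemma run_letter_mono:
  assumes xs: "twin_runs xs L0 R0 m n" and ys: "twin_runs ys L1 R1 m n"
    and inv: "inversions_le xs ys" and i: "m \<le> i" "i < n"
  shows "(if L0 i \<noteq> 0 then - int (L0 i) else int (R0 i)) \<le>
      (if L1 i \<noteq> 0 then - int (L1 i) else int (R1 i))"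
proof -
  have sx: "set xs = {m..<n}" and L0: "runs xs L0 m n" and R0: "runs (rev xs) R0 m n"
    using xs by (auto simp: twin_runs_def)
  have dy: "distinct ys" and L1: "runs ys L1 m n" and R1: "runs (rev ys) R1 m n"
    using ys by (auto simp: twin_runs_def)
  have mono: "before ys j i" if "before xs j i" "i < j" for j
    using inv that by (auto simp: inversions_le_def)
  have "L1 i \<le> L0 i"
  proof (rule ccontr)
    let ?c = "Suc (i + L0 i)"
    assume "\<not> L1 i \<le> L0 i"
    then have c: "before ys i ?c" "?c < n"
      using runs_before[OF L1, of i ?c] runs_less[OF L1, of i] i by auto
    then have "before xs ?c i"
      using runs_end[OF L0, of i] before_total[of i xs ?c] sx i by auto
    then show False using mono[of ?c] c before_asym[OF dy] by auto
  qed
  moreover have "R0 i \<le> R1 i"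
  proof (rule ccontr)
    let ?c = "Suc (i + R1 i)"
    assume "\<not> R0 i \<le> R1 i"
    then have "before xs ?c i" "?c < n"
      using runs_before[OF R0, of i ?c] runs_less[OF R0, of i] i by auto
    then show False using runs_end[OF R1, of i] mono[of ?c] i by auto
  qed
  \<comment> \<open>If \<open>L0 i = 0\<close> then \<open>L1 i = 0\<close>, so the letter never
    drops from nonnegative to negative.\<close>
  ultimately show ?thesis by auto
qed

section \<open>The Baxter order\<close>

theorem proposition5p4:
  fixes n :: nat and J\<^sub>0 J\<^sub>1 :: "shape \<times> shape"
  assumes "twin_trees n J\<^sub>0" and "twin_trees n J\<^sub>1"
  shows "baxter_le n J\<^sub>0 J\<^sub>1 \<longleftrightarrow>
    (\<forall>i \<in> {1..n}. omega (ttd J\<^sub>0) ! (i - 1) \<le> omega (ttd J\<^sub>1) ! (i - 1))"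
proof -
  \<comment> \<open>Diagrams indexed by the letters \<open>1\<close> to \<open>n\<close> instead of
    list positions.\<close>
  define L R where "L = (\<lambda>(J :: shape \<times> shape) i. td (fst J) ! (i - 1))"
    and "R = (\<lambda>(J :: shape \<times> shape) i. td (snd J) ! (i - 1))"
  have letter: "omega (ttd J) ! (i - 1) = (if L J i \<noteq> 0 then - int (L J i) else int (R J i))"
    if "i \<in> {1..n}" "twin_trees n J" for i J
    using that by (subst omega_nth) (auto simp: twin_trees_def L_def R_def)
  \<comment> \<open>From here on both directions are statements about words only.\<close>
  have P_iff: "xs \<in> perms n \<and> P_symbol xs = J \<longleftrightarrow> twin_runs xs (L J) (R J) 1 (Suc n)"
    if "twin_trees n J" for xs J
  proof -
    have "xs \<in> perms n \<longleftrightarrow> distinct xs \<and> set xs = {1..<Suc n}"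
      by (auto simp: permutations_of_set_def atLeastLessThanSuc_atLeastAtMost)
    then show ?thesis
      using that P_symbol_eq_iff[of xs n J]
      unfolding twin_runs_def twin_trees_def L_def R_def by blast
  qed
  show ?thesis
  proof
    assume "baxter_le n J\<^sub>0 J\<^sub>1"
    then obtain xs ys where "twin_runs xs (L J\<^sub>0) (R J\<^sub>0) 1 (Suc n)"
      "twin_runs ys (L J\<^sub>1) (R J\<^sub>1) 1 (Suc n)" "inversions_le xs ys"
      unfolding baxter_le_def permutohedron_le_def
      using P_iff assms permutohedron_rtranclp_inversions_le by metis
    then have "(if L J\<^sub>0 i \<noteq> 0 then - int (L J\<^sub>0 i) else int (R J\<^sub>0 i)) \<le>
        (if L J\<^sub>1 i \<noteq> 0 then - int (L J\<^sub>1 i) else int (R J\<^sub>1 i))" if "i \<in> {1..n}" for i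
      using that run_letter_mono by simp
    then show "\<forall>i \<in> {1..n}. omega (ttd J\<^sub>0) ! (i - 1) \<le> omega (ttd J\<^sub>1) ! (i - 1)"
      using letter[OF _ assms(1)] letter[OF _ assms(2)] by simp
  next
    assume le: "\<forall>i \<in> {1..n}. omega (ttd J\<^sub>0) ! (i - 1) \<le> omega (ttd J\<^sub>1) ! (i - 1)"
    have tamari: "tamari (L J) 1 (Suc n)" "tamari (R J) 1 (Suc n)" if "twin_trees n J" for J
      using that tamari_td[of "fst J" 1] tamari_td[of "snd J" 1]
      by (auto simp: twin_trees_def L_def R_def)
    have "\<exists>xs ys. twin_runs xs (L J\<^sub>0) (R J\<^sub>0) 1 (Suc n) \<and> twin_runs ys (L J\<^sub>1) (R J\<^sub>1) 1 (Suc n) \<and>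
        inversions_le xs ys"
    proof (rule ex_twin_runs_pair)
      show "(L J\<^sub>0 i = 0) \<noteq> (R J\<^sub>0 i = 0)" "(L J\<^sub>1 i = 0) \<noteq> (R J\<^sub>1 i = 0)"
        if "1 \<le> i" "Suc i < Suc n" for i
        using that twin_trees_td assms by (auto simp: L_def R_def)
      show "(if L J\<^sub>0 i \<noteq> 0 then - int (L J\<^sub>0 i) else int (R J\<^sub>0 i)) \<le>
          (if L J\<^sub>1 i \<noteq> 0 then - int (L J\<^sub>1 i) else int (R J\<^sub>1 i))" if "1 \<le> i" "i < Suc n" for i
        using that le[rule_format, of i] letter[of i J\<^sub>0] letter[of i J\<^sub>1] assms by simp
    qed (use tamari assms in auto)
    then obtain xs ys where runs: "twin_runs xs (L J\<^sub>0) (R J\<^sub>0) 1 (Suc n)"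
      "twin_runs ys (L J\<^sub>1) (R J\<^sub>1) 1 (Suc n)" and inv: "inversions_le xs ys"
      by blast
    then have "permutohedron_covers\<^sup>*\<^sup>* xs ys"
      by (intro inversions_le_permutohedron) (auto simp: twin_runs_def)
    then show "baxter_le n J\<^sub>0 J\<^sub>1"
      unfolding baxter_le_def permutohedron_le_def
      using runs P_iff assms by blast
  qed
qed

end
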